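(* Let $n\geq 3$ and let $\bm{X}=\{X_i\}_{i=1}^n$ be a sequence of independent Bernoulli trials, each with probability of success $\mathbb{P}(X_i=1)=p$, where $0<p<1$. For every integer $k$ with $1\leq k\leq n-2$, let $I_k(\bm{X})=\{i\in\{k+1,\dots,n\}:\prod_{j=i-k}^{i-1}X_j=1\}$ be the set of trials that immediately follow $k$ consecutive successes, and let $\hat{P}_k(\bm{X}):=\sum_{i\in I_k(\bm{X})}X_i/|I_k(\bm{X})|$ (defined when $I_k(\bm{X})\neq\emptyset$) be the proportion of successes on these trials. Then $\hat{P}_k(\bm{X})$ is a biased estimator of $\mathbb{P}\left(X_t=1\,\middle|\,\prod_{j=t-k}^{t-1}X_j=1\right)\equiv p$; in particular, $$E\left[\hat{P}_k(\bm{X})\,\middle|\,I_k(\bm{X})\neq\emptyset\right]<p.$$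
   Context: Each $X_i$ takes values in $\{0,1\}$; $X_i=1$ is a "success" and $X_i=0$ a "failure". The expectation is conditional on the event $I_k(\bm{X})\neq\emptyset$, i.e. on the event that at least one streak of $k$ consecutive successes occurs within the first $n-1$ trials. *)

theory Defs
  imports "HOL-Probability.Probability"
begin

definition streak_trials :: "nat \<Rightarrow> nat \<Rightarrow> (nat \<Rightarrow> real) \<Rightarrow> nat set" where
  "streak_trials n k x = {i \<in> {k + 1..n}. (\<Prod>j = i - k..i - 1. x j) = 1}"

(* Only meaningful when streak_trials n k x is nonempty. *)
definition P_hat :: "nat \<Rightarrow> nat \<Rightarrow> (nat \<Rightarrow> real) \<Rightarrow> real" where
  "P_hat n k x = (\<Sum>i \<in> streak_trials n k x. x i) / real (card (streak_trials n k x))"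

(* The expectation of f given the event A is its integral over uniform_measure M A,
   which is the conditional probability measure M( . | A) whenever A has positive probability. *)
definition expectation_given :: "'a measure \<Rightarrow> ('a \<Rightarrow> real) \<Rightarrow> 'a set \<Rightarrow> real" where
  "expectation_given M f A = integral\<^sup>L (uniform_measure M A) f"

(* Bias of an estimator that is defined on the event A only. *)
definition biased_estimator_given ::
    "'a measure \<Rightarrow> ('a \<Rightarrow> real) \<Rightarrow> 'a set \<Rightarrow> real \<Rightarrow> bool" where
  "biased_estimator_given M f A \<theta> \<longleftrightarrow> expectation_given M f A \<noteq> \<theta>"

end

theory Submission
  imports Defs
begin

text \<open>
  Averaging over the streak trials, the bias times the probability of the conditioning event is
  the sum over \<open>t\<close> of the mean of \<open>(X t - p) / card I\<close> on the event \<open>t \<in> I\<close>, where \<open>I\<close> is the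
  set of streak trials. Whether \<open>t \<in> I\<close> does not depend on \<open>X t\<close>, whereas turning
  \<open>X t\<close> from failure into success can only enlarge \<open>I\<close>, so integrating out \<open>X t\<close> first shows
  that every summand is at most \<open>0\<close>. The summand \<open>t = k + 1\<close> is negative because on the
  all-success sequence \<open>X t\<close> decides whether \<open>t + 1 \<in> I\<close>; this uses \<open>k + 2 \<le> n\<close>.
\<close>

section \<open>Product Bernoulli weights on the subsets of a finite set\<close>

lemma sum_Pow_insert:
  fixes f :: "'b set \<Rightarrow> 'c::comm_monoid_add"
  assumes "finite A" "t \<notin> A"
  shows "(\<Sum>S\<in>Pow (insert t A). f S) = (\<Sum>S\<in>Pow A. f S + f (insert t S))"
proof -
  have "inj_on (insert t) (Pow A)"
    using assms by (auto simp: inj_on_def)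
  moreover have "Pow A \<inter> insert t ` Pow A = {}"
    using assms by auto
  ultimately show ?thesis
    using assms by (simp add: Pow_insert sum.union_disjoint sum.reindex sum.distrib)
qed

text \<open>A 0-1 sequence indexed by \<open>N\<close> is encoded as the set \<open>S\<close> of its
  successes. The weight is the probability of that outcome under independent trials.\<close>

definition bernoulli_weight :: "real \<Rightarrow> 'b set \<Rightarrow> 'b set \<Rightarrow> real" where
  "bernoulli_weight p N S = (\<Prod>i\<in>N. if i \<in> S then p else 1 - p)"

definition bernoulli_mean :: "real \<Rightarrow> 'b set \<Rightarrow> ('b set \<Rightarrow> real) \<Rightarrow> real" where
  "bernoulli_mean p N f = (\<Sum>S\<in>Pow N. bernoulli_weight p N S * f S)"

lemma bernoulli_weight_pos: "0 < p \<Longrightarrow> p < 1 \<Longrightarrow> 0 < bernoulli_weight p N S"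
  unfolding bernoulli_weight_def by (rule prod_pos) auto

text \<open>Source of strictness: for \<open>0 < p\<close> and \<open>p < 1\<close> no outcome has
  weight zero, so one outcome \<open>T\<close> with a positive value suffices.\<close>

lemma bernoulli_mean_pos:
  assumes "0 < p" "p < 1" "finite N" "\<And>S. S \<subseteq> N \<Longrightarrow> 0 \<le> f S" "T \<subseteq> N" "0 < f T"
  shows "0 < bernoulli_mean p N f"
  unfolding bernoulli_mean_def
proof (rule sum_pos2[where i = T])
  show "0 < bernoulli_weight p N T * f T"
    using assms bernoulli_weight_pos[of p N T] by simp
  show "0 \<le> bernoulli_weight p N S * f S" if "S \<in> Pow N" for S
    using that assms bernoulli_weight_pos[of p N S] by simp
qed (use assms in auto)

lemma bernoulli_mean_sum:
  "bernoulli_mean p N (\<lambda>S. \<Sum>t\<in>T. f t S) = (\<Sum>t\<in>T. bernoulli_mean p N (f t))"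
  unfolding bernoulli_mean_def sum_distrib_left by (rule sum.swap)

lemma bernoulli_mean_diff_mult:
  "bernoulli_mean p N (\<lambda>S. f S - c * g S) = bernoulli_mean p N f - c * bernoulli_mean p N g"
  by (simp add: bernoulli_mean_def right_diff_distrib sum_subtractf sum_distrib_left mult.left_commute)

text \<open>Pair each \<open>S\<close> avoiding \<open>t\<close> with \<open>insert t S\<close>.
  With \<open>w\<close> the weight of the other trials, the pair has weights
  \<open>(1 - p) * w\<close> and \<open>p * w\<close> and centred values \<open>- p\<close> and
  \<open>1 - p\<close>, so both products are \<open>p * (1 - p) * w\<close> up to sign.\<close>

lemma bernoulli_mean_centered:
  assumes "finite N" "t \<in> N"
  shows "bernoulli_mean p N (\<lambda>S. (indicator S t - p) * h S)
    = p * (1 - p) * bernoulli_mean p (N - {t}) (\<lambda>S. h (insert t S) - h S)"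
proof -
  define A where "A = N - {t}"
  have A: "finite A" "t \<notin> A" "N = insert t A"
    using assms by (auto simp: A_def)
  have w: "bernoulli_weight p (insert t A) S = (1 - p) * bernoulli_weight p A S"
    "bernoulli_weight p (insert t A) (insert t S) = p * bernoulli_weight p A S"
    if "S \<subseteq> A" for S
  proof -
    have "t \<notin> S" using that A by auto
    moreover have "bernoulli_weight p A (insert t S) = bernoulli_weight p A S"
      unfolding bernoulli_weight_def using A by (intro prod.cong) auto
    ultimately show "bernoulli_weight p (insert t A) S = (1 - p) * bernoulli_weight p A S"
      "bernoulli_weight p (insert t A) (insert t S) = p * bernoulli_weight p A S"
      using A by (auto simp: bernoulli_weight_def)
  qed
  have "bernoulli_mean p N (\<lambda>S. (indicator S t - p) * h S)
    = (\<Sum>S\<in>Pow A. p * (1 - p) * (bernoulli_weight p A S * (h (insert t S) - h S)))"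
    unfolding bernoulli_mean_def A(3) sum_Pow_insert[OF A(1,2)]
  proof (rule sum.cong[OF refl])
    fix S assume "S \<in> Pow A"
    then have "S \<subseteq> A" "t \<notin> S" using A by auto
    then show "bernoulli_weight p (insert t A) S * ((indicator S t - p) * h S)
        + bernoulli_weight p (insert t A) (insert t S)
          * ((indicator (insert t S) t - p) * h (insert t S))
      = p * (1 - p) * (bernoulli_weight p A S * (h (insert t S) - h S))"
      by (simp add: w algebra_simps)
  qed
  then show ?thesis
    by (simp add: bernoulli_mean_def A_def sum_distrib_left)
qed

section \<open>Streak trials and the estimator on success sets\<close>

lemma streak_trials_cong:
  assumes "\<And>i. i \<in> {1..n} \<Longrightarrow> x i = y i" "1 \<le> k"
  shows "streak_trials n k x = streak_trials n k y"
proof -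
  have "(\<Prod>j = i - k..i - 1. x j) = (\<Prod>j = i - k..i - 1. y j)" if "i \<in> {k + 1..n}" for i
    using that assms(2) by (intro prod.cong refl assms(1)) auto
  then show ?thesis
    by (auto simp: streak_trials_def)
qed

text \<open>Needed because a success set determines the trials only on \<open>{1..n}\<close>:
  elsewhere its indicator is \<open>0\<close>, while the given sequence is arbitrary.\<close>

lemma P_hat_cong:
  assumes "\<And>i. i \<in> {1..n} \<Longrightarrow> x i = y i" "1 \<le> k"
  shows "P_hat n k x = P_hat n k y"
proof -
  have "(\<Sum>i \<in> streak_trials n k y. x i) = (\<Sum>i \<in> streak_trials n k y. y i)"
    by (intro sum.cong refl assms(1)) (auto simp: streak_trials_def)
  then show ?thesis
    using streak_trials_cong[of n x y k] assms by (simp add: P_hat_def)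
qed

lemma prod_indicator_eq_1_iff:
  assumes "finite J"
  shows "(\<Prod>j\<in>J. indicat_real S j) = 1 \<longleftrightarrow> J \<subseteq> S"
proof -
  have "(\<Prod>j\<in>J. indicat_real S j) = (if J \<subseteq> S then 1 else 0)"
    using assms by (auto simp: indicator_def subset_iff prod_zero_iff)
  then show ?thesis by simp
qed

text \<open>As an inclusion, the condition is visibly monotone in \<open>S\<close> and depends on
  \<open>S\<close> only inside the window.\<close>

lemma streak_trials_indicator:
  "streak_trials n k (indicator S) = {i \<in> {k + 1..n}. {i - k..i - 1} \<subseteq> S}"
  by (simp add: streak_trials_def prod_indicator_eq_1_iff)

lemma finite_streak_trials: "finite (streak_trials n k x)"
  by (simp add: streak_trials_def)

text \<open>Subtracting \<open>p\<close> from an average subtracts it from each term. Zero terms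
  extend the sum to a range independent of \<open>x\<close>, so that means can be taken term by
  term; without streak trials both sides vanish.\<close>

lemma P_hat_centered:
  "(if streak_trials n k x = {} then 0 else P_hat n k x - p)
   = (\<Sum>t = k + 1..n. (x t - p) *
       (if t \<in> streak_trials n k x then 1 / real (card (streak_trials n k x)) else 0))"
proof -
  let ?I = "streak_trials n k x"
  have "(\<Sum>t = k + 1..n. (x t - p) * (if t \<in> ?I then 1 / real (card ?I) else 0))
    = (\<Sum>t\<in>?I. (x t - p) / real (card ?I))"
    by (rule sum.mono_neutral_cong_right) (auto simp: streak_trials_def)
  also have "\<dots> = ((\<Sum>t\<in>?I. x t) - real (card ?I) * p) / real (card ?I)"
    by (simp add: sum_divide_distrib[symmetric] sum_subtractf)
  also have "\<dots> = (if ?I = {} then 0 else P_hat n k x - p)"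
    using finite_streak_trials[of n k x] by (simp add: P_hat_def diff_divide_distrib)
  finally show ?thesis by simp
qed

text \<open>The default \<open>0\<close> on sequences without streak trials allows an unconditional
  mean, whose sign is that of the bias.\<close>

lemma bernoulli_mean_P_hat_neg:
  assumes "0 < p" "p < 1" "1 \<le> k" "k + 2 \<le> n"
  shows "bernoulli_mean p {1..n} (\<lambda>S. if streak_trials n k (indicator S) = {} then 0
    else P_hat n k (indicator S) - p) < 0"
proof -
  define I where "I S = streak_trials n k (indicator S)" for S
  define h where "h t S = (if t \<in> I S then 1 / real (card (I S)) else 0)" for t S
  \<comment> \<open>\<open>D t\<close> is oriented as the mean loss in \<open>h t\<close> when trial
    \<open>t\<close> turns into a success; this reverses the difference in
    \<open>bernoulli_mean_centered\<close> and causes the minus sign below.\<close>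
  define D where "D t = bernoulli_mean p ({1..n} - {t}) (\<lambda>S. h t S - h t (insert t S))" for t
  have fin: "finite (I S)" for S
    by (simp add: I_def finite_streak_trials)
  have mono: "I S \<subseteq> I (insert t S)" for t S
    by (auto simp: I_def streak_trials_indicator)
  have mem: "t \<in> I (insert t S) \<longleftrightarrow> t \<in> I S" for t S
  proof -
    \<comment> \<open>The range matters: at \<open>t = 0\<close> truncated subtraction would put
      \<open>t\<close> into its own window.\<close>
    have "t \<notin> {t - k..t - 1}" if "t \<in> {k + 1..n}" using that by auto
    then show ?thesis by (auto simp: I_def streak_trials_indicator)
  qed
  \<comment> \<open>Membership of \<open>t\<close> is unchanged while the set of streak trials can
    only grow, so the reciprocal of its size can only fall.\<close>
  have nonneg: "0 \<le> h t S - h t (insert t S)" for t S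
  proof (cases "t \<in> I S")
    case True
    then have "0 < card (I S)" using fin card_gt_0_iff by blast
    then show ?thesis
      using True mem[of t S] card_mono[OF fin mono] by (simp add: h_def frac_le)
  qed (simp add: h_def mem)
  have D_nonneg: "0 \<le> D t" for t
    unfolding D_def bernoulli_mean_def
    using nonneg less_imp_le[OF bernoulli_weight_pos[OF assms(1,2)]]
    by (intro sum_nonneg mult_nonneg_nonneg)
  have D_pos: "0 < D (k + 1)"
    unfolding D_def
  \<comment> \<open>The witness fails only at trial \<open>k + 1\<close>. The window
    \<open>{1..k}\<close> is intact, so \<open>k + 1\<close> is a streak trial, and repairing the
    failure adds the streak trial \<open>k + 2\<close>.\<close>
  proof (rule bernoulli_mean_pos[where T = "{1..n} - {k + 1}"])
    let ?T = "{1..n} - {k + 1}"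
    have T: "insert (k + 1) ?T = {1..n}" using assms by auto
    have k1: "k + 1 \<in> I ?T" using assms by (auto simp: I_def streak_trials_indicator)
    \<comment> \<open>The window of \<open>k + 2\<close> is \<open>{2..k + 1}\<close>, which
      contains the failure because \<open>1 \<le> k\<close>.\<close>
    have "k + 1 \<in> {k + 2 - k..k + 2 - 1}" using assms by simp
    then have "\<not> {k + 2 - k..k + 2 - 1} \<subseteq> ?T" by blast
    then have "k + 2 \<in> I {1..n}" "k + 2 \<notin> I ?T"
      using assms unfolding I_def streak_trials_indicator by auto
    then have "I ?T \<subset> I {1..n}" using mono[of ?T "k + 1"] T by auto
    then have "card (I ?T) < card (I {1..n})" by (rule psubset_card_mono[OF fin])
    moreover have "0 < card (I ?T)" using k1 fin card_gt_0_iff by blast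
    ultimately show "0 < h (k + 1) ?T - h (k + 1) (insert (k + 1) ?T)"
      using k1 mem[of "k + 1" ?T] unfolding T by (simp add: h_def frac_less2)
  qed (use assms nonneg in auto)
  have "(\<lambda>S. if I S = {} then 0 else P_hat n k (indicator S) - p)
      = (\<lambda>S. \<Sum>t = k + 1..n. (indicator S t - p) * h t S)"
    unfolding I_def h_def by (rule ext) (rule P_hat_centered)
  then have "bernoulli_mean p {1..n} (\<lambda>S. if I S = {} then 0 else P_hat n k (indicator S) - p)
      = (\<Sum>t = k + 1..n. bernoulli_mean p {1..n} (\<lambda>S. (indicator S t - p) * h t S))"
    by (simp add: bernoulli_mean_sum)
  also have "\<dots> = (\<Sum>t = k + 1..n. - (p * (1 - p) * D t))"
  proof (rule sum.cong[OF refl])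
    fix t assume "t \<in> {k + 1..n}"
    then show "bernoulli_mean p {1..n} (\<lambda>S. (indicator S t - p) * h t S) = - (p * (1 - p) * D t)"
      by (subst bernoulli_mean_centered)
        (auto simp: D_def bernoulli_mean_def sum_negf[symmetric] right_diff_distrib sum_subtractf)
  qed
  also have "\<dots> = - (p * (1 - p) * (\<Sum>t = k + 1..n. D t))"
    by (simp add: sum_negf sum_distrib_left)
  also have "\<dots> < 0"
  proof -
    have "0 < (\<Sum>t = k + 1..n. D t)"
      using D_nonneg D_pos assms by (intro sum_pos2[where i = "k + 1"]) auto
    then show ?thesis using assms by simp
  qed
  finally show ?thesis by (simp add: I_def)
qed

section \<open>From a probability space to weighted sums over success sets\<close>

lemma (in finite_measure) integral_uniform_measure:
  fixes f :: "'a \<Rightarrow> real"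
  assumes "A \<in> sets M" "f \<in> borel_measurable M" "measure M A \<noteq> 0"
  shows "integral\<^sup>L (uniform_measure M A) f = (\<integral>x. indicator A x * f x \<partial>M) / measure M A"
proof -
  have pos: "0 < measure M A"
    using assms(3) by (simp add: zero_less_measure_iff)
  \<comment> \<open>Positivity of \<open>measure M A\<close> turns the extended quotient into a real
    one, so the density formula for real integrals applies.\<close>
  have "indicator A x / emeasure M A = ennreal (indicator A x / measure M A)" for x
    using pos by (simp add: emeasure_eq_measure divide_ennreal[symmetric] ennreal_indicator)
  then have "uniform_measure M A = density M (\<lambda>x. ennreal (indicator A x / measure M A))"
    by (simp add: uniform_measure_def)
  then have "integral\<^sup>L (uniform_measure M A) f
      = (\<integral>x. (indicator A x / measure M A) *\<^sub>R f x \<partial>M)"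
    using assms by (simp add: integral_density)
  then show ?thesis by simp
qed

locale bernoulli_trials = prob_space M for M :: "'a measure" +
  fixes N :: "'b set" and X :: "'b \<Rightarrow> 'a \<Rightarrow> real" and p :: real
  assumes finite_N: "finite N" and N_nonempty: "N \<noteq> {}"
    and X_01: "\<And>i \<omega>. i \<in> N \<Longrightarrow> \<omega> \<in> space M \<Longrightarrow> X i \<omega> \<in> {0, 1}"
    and indep: "indep_vars (\<lambda>_. borel) X N"
    and prob_success: "\<And>i. i \<in> N \<Longrightarrow> \<P>(\<omega> in M. X i \<omega> = 1) = p"
begin

text \<open>The random set through which all functions of the trials are expressed; its law is
  \<open>bernoulli_weight p N\<close>.\<close>

definition successes :: "'a \<Rightarrow> 'b set" where
  "successes \<omega> = {i \<in> N. X i \<omega> = 1}"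

lemma X_eq_indicator: "i \<in> N \<Longrightarrow> \<omega> \<in> space M \<Longrightarrow> X i \<omega> = indicator (successes \<omega>) i"
  using X_01[of i \<omega>] by (auto simp: successes_def)

lemma successes_eq_Inter:
  assumes "S \<subseteq> N"
  shows "{\<omega> \<in> space M. successes \<omega> = S} = (\<Inter>i\<in>N. X i -` {indicator S i} \<inter> space M)"
proof (intro set_eqI iffI)
  fix \<omega> assume "\<omega> \<in> {\<omega> \<in> space M. successes \<omega> = S}"
  then show "\<omega> \<in> (\<Inter>i\<in>N. X i -` {indicator S i} \<inter> space M)"
    using X_eq_indicator by auto
next
  fix \<omega> assume *: "\<omega> \<in> (\<Inter>i\<in>N. X i -` {indicator S i} \<inter> space M)"
  then have "i \<in> successes \<omega> \<longleftrightarrow> i \<in> S" for i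
    using assms by (cases "i \<in> N") (auto simp: successes_def indicator_def split: if_splits)
  then show "\<omega> \<in> {\<omega> \<in> space M. successes \<omega> = S}"
    \<comment> \<open>An index in \<open>N\<close> is what places \<open>\<omega>\<close> in
      \<open>space M\<close>; an empty intersection would be the whole type.\<close>
    using * N_nonempty by auto
qed

lemma measurable_X: "i \<in> N \<Longrightarrow> X i \<in> borel_measurable M"
  using indep by (auto simp: indep_vars_def)

lemma successes_event: "S \<subseteq> N \<Longrightarrow> {\<omega> \<in> space M. successes \<omega> = S} \<in> events"
  unfolding successes_eq_Inter
  using finite_N N_nonempty by (intro sets.finite_INT measurable_sets[OF measurable_X]) auto

text \<open>Independence factors the event over the trials; since they are 0-1 valued, failure is
  the complement of success and has probability \<open>1 - p\<close>.\<close>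

lemma prob_successes:
  assumes "S \<subseteq> N"
  shows "prob {\<omega> \<in> space M. successes \<omega> = S} = bernoulli_weight p N S"
proof -
  have "prob (X i -` {indicator S i} \<inter> space M) = (if i \<in> S then p else 1 - p)" if "i \<in> N" for i
  proof -
    have E: "{\<omega> \<in> space M. X i \<omega> = 1} \<in> events"
      using measurable_X[OF that] by measurable
    have "X i -` {1} \<inter> space M = {\<omega> \<in> space M. X i \<omega> = 1}"
      "X i -` {0} \<inter> space M = space M - {\<omega> \<in> space M. X i \<omega> = 1}"
      using X_01[OF that] by auto
    then show ?thesis
      using prob_success[OF that] prob_compl[OF E] by simp
  qed
  then show ?thesis
    unfolding successes_eq_Inter[OF assms] bernoulli_weight_def
    using indep_varsD_finite[OF indep N_nonempty finite_N, of "\<lambda>i. {indicator S i}"] by simp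
qed

text \<open>Exhibits any function of the trials as a simple function, which reduces integrability
  and expectation to finite sums.\<close>

lemma successes_expand:
  fixes f :: "'b set \<Rightarrow> real"
  assumes "\<omega> \<in> space M"
  shows "f (successes \<omega>) = (\<Sum>S\<in>Pow N. f S * indicator {\<omega> \<in> space M. successes \<omega> = S} \<omega>)"
proof -
  have "(\<Sum>S\<in>Pow N. f S * indicator {\<omega> \<in> space M. successes \<omega> = S} \<omega>)
      = (\<Sum>S\<in>Pow N. if successes \<omega> = S then f S else 0)"
    using assms by (intro sum.cong) auto
  also have "\<dots> = f (successes \<omega>)"
    using finite_N by (simp add: successes_def)
  finally show ?thesis by simp
qed

lemma
  fixes f :: "'b set \<Rightarrow> real"
  shows integrable_successes: "integrable M (\<lambda>\<omega>. f (successes \<omega>))"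
    and expectation_successes: "expectation (\<lambda>\<omega>. f (successes \<omega>)) = bernoulli_mean p N f"
proof -
  let ?g = "\<lambda>\<omega>. \<Sum>S\<in>Pow N. f S * indicator {\<omega> \<in> space M. successes \<omega> = S} \<omega>"
  have *: "integrable M (\<lambda>\<omega>. f S * indicator {\<omega> \<in> space M. successes \<omega> = S} \<omega>)"
    if "S \<in> Pow N" for S
    using that successes_event[of S]
    by (intro integrable_mult_right integrable_real_indicator) (auto simp: emeasure_eq_measure)
  have "integrable M ?g"
    using * by (rule Bochner_Integration.integrable_sum)
  then show "integrable M (\<lambda>\<omega>. f (successes \<omega>))"
    by (subst Bochner_Integration.integrable_cong[OF refl successes_expand])
  have "expectation (\<lambda>\<omega>. f (successes \<omega>)) = expectation ?g"
    by (intro Bochner_Integration.integral_cong refl successes_expand)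
  also have "\<dots> = (\<Sum>S\<in>Pow N. expectation
      (\<lambda>\<omega>. f S * indicator {\<omega> \<in> space M. successes \<omega> = S} \<omega>))"
    by (rule Bochner_Integration.integral_sum[OF *])
  also have "\<dots> = bernoulli_mean p N f"
    unfolding bernoulli_mean_def
    using successes_event prob_successes by (intro sum.cong) (auto simp: Int_def conj_ac)
  finally show "expectation (\<lambda>\<omega>. f (successes \<omega>)) = bernoulli_mean p N f" .
qed

lemma
  shows events_successes: "{\<omega> \<in> space M. P (successes \<omega>)} \<in> events"
    and prob_successes_pred:
      "\<P>(\<omega> in M. P (successes \<omega>)) = bernoulli_mean p N (\<lambda>S. of_bool (P S))"
proof -
  \<comment> \<open>Measurability is obtained from integrability, and the event is then the preimage
    of \<open>1\<close>.\<close>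
  have "(\<lambda>\<omega>. of_bool (P (successes \<omega>)) :: real) \<in> borel_measurable M"
    by (rule borel_measurable_integrable[OF integrable_successes])
  then have "(\<lambda>\<omega>. of_bool (P (successes \<omega>)) :: real) -` {1} \<inter> space M \<in> events"
    by (rule measurable_sets) simp
  also have "(\<lambda>\<omega>. of_bool (P (successes \<omega>)) :: real) -` {1} \<inter> space M
      = {\<omega> \<in> space M. P (successes \<omega>)}"
    by auto
  finally show E: "{\<omega> \<in> space M. P (successes \<omega>)} \<in> events" .
  have "\<P>(\<omega> in M. P (successes \<omega>)) = expectation (indicator {\<omega> \<in> space M. P (successes \<omega>)})"
    using E by (simp add: Int_def conj_ac)
  also have "\<dots> = expectation (\<lambda>\<omega>. of_bool (P (successes \<omega>)))"
    by (intro Bochner_Integration.integral_cong) auto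
  also have "\<dots> = bernoulli_mean p N (\<lambda>S. of_bool (P S))"
    by (rule expectation_successes)
  finally show "\<P>(\<omega> in M. P (successes \<omega>)) = bernoulli_mean p N (\<lambda>S. of_bool (P S))" .
qed

text \<open>As \<open>t\<close> lies outside \<open>J\<close>, inserting \<open>t\<close> does not
  affect \<open>J \<subseteq> S\<close>. Hence \<open>bernoulli_mean_centered\<close> gives mean
  zero, so the joint probability is \<open>p\<close> times that of the condition.\<close>

lemma cond_prob_success_given_others:
  assumes "0 < p" "p < 1" "J \<subseteq> N" "t \<in> N - J"
  shows "\<P>(\<omega> in M. X t \<omega> = 1 \<bar> (\<Prod>j\<in>J. X j \<omega>) = 1) = p"
proof -
  have "finite J" using assms(3) finite_N finite_subset by blast
  have "bernoulli_mean p N (\<lambda>S. (indicator S t - p) * of_bool (J \<subseteq> S)) = 0"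
  proof -
    have "J \<subseteq> insert t S \<longleftrightarrow> J \<subseteq> S" for S using assms(4) by auto
    then show ?thesis
      using assms(4) by (subst bernoulli_mean_centered[OF finite_N]) (auto simp: bernoulli_mean_def)
  qed
  moreover have "(\<lambda>S. (indicator S t - p) * of_bool (J \<subseteq> S))
      = (\<lambda>S. of_bool (t \<in> S \<and> J \<subseteq> S) - p * of_bool (J \<subseteq> S))"
    by (auto simp: fun_eq_iff algebra_simps)
  ultimately have mean: "bernoulli_mean p N (\<lambda>S. of_bool (t \<in> S \<and> J \<subseteq> S))
      = p * bernoulli_mean p N (\<lambda>S. of_bool (J \<subseteq> S))"
    by (simp add: bernoulli_mean_diff_mult)
  \<comment> \<open>The all-success outcome makes the condition non-null, as the division in the
    conditional probability requires.\<close>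
  have pos: "0 < bernoulli_mean p N (\<lambda>S. of_bool (J \<subseteq> S))"
    using assms finite_N by (intro bernoulli_mean_pos[where T = N]) auto
  have prod: "(\<Prod>j\<in>J. X j \<omega>) = 1 \<longleftrightarrow> J \<subseteq> successes \<omega>" if "\<omega> \<in> space M" for \<omega>
  proof -
    have "(\<Prod>j\<in>J. X j \<omega>) = (\<Prod>j\<in>J. indicat_real (successes \<omega>) j)"
      using that assms(3) by (intro prod.cong refl X_eq_indicator) auto
    then show ?thesis by (simp add: prod_indicator_eq_1_iff \<open>finite J\<close>)
  qed
  have "X t \<omega> = 1 \<longleftrightarrow> t \<in> successes \<omega>" for \<omega>
    using assms(4) by (simp add: successes_def)
  then have "{\<omega> \<in> space M. X t \<omega> = 1 \<and> (\<Prod>j\<in>J. X j \<omega>) = 1}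
      = {\<omega> \<in> space M. t \<in> successes \<omega> \<and> J \<subseteq> successes \<omega>}"
    "{\<omega> \<in> space M. (\<Prod>j\<in>J. X j \<omega>) = 1} = {\<omega> \<in> space M. J \<subseteq> successes \<omega>}"
    using prod by auto
  then show ?thesis
    using mean pos prob_successes_pred[of "\<lambda>S. t \<in> S \<and> J \<subseteq> S"] prob_successes_pred[of "\<lambda>S. J \<subseteq> S"]
    by (simp add: cond_prob_def)
qed

end

section \<open>The conditional expectation and its bias\<close>

theorem theorem1:
  fixes M :: "'a measure" and X :: "nat \<Rightarrow> 'a \<Rightarrow> real" and n k :: nat and p :: real
  assumes "prob_space M"
    and "n \<ge> 3"
    and "0 < p" and "p < 1"
    and "\<And>i \<omega>. i \<in> {1..n} \<Longrightarrow> \<omega> \<in> space M \<Longrightarrow> X i \<omega> \<in> {0, 1}"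
    and "prob_space.indep_vars M (\<lambda>_. borel) X {1..n}"
    and "\<And>i. i \<in> {1..n} \<Longrightarrow> \<P>(\<omega> in M. X i \<omega> = 1) = p"
    and "1 \<le> k" and "k \<le> n - 2"
  defines "A \<equiv> {\<omega> \<in> space M. streak_trials n k (\<lambda>i. X i \<omega>) \<noteq> {}}"
  shows "(\<forall>t \<in> {k + 1..n}.
            \<P>(\<omega> in M. X t \<omega> = 1 \<bar> (\<Prod>j = t - k..t - 1. X j \<omega>) = 1) = p \<and>
            biased_estimator_given M (\<lambda>\<omega>. P_hat n k (\<lambda>i. X i \<omega>)) A
              (\<P>(\<omega> in M. X t \<omega> = 1 \<bar> (\<Prod>j = t - k..t - 1. X j \<omega>) = 1))) \<and>
         expectation_given M (\<lambda>\<omega>. P_hat n k (\<lambda>i. X i \<omega>)) A < p"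
proof -
  have kn: "k + 2 \<le> n" using assms(2,9) by simp
  interpret bernoulli_trials M "{1..n}" X p
    using assms(1,2,5-7) by (simp add: bernoulli_trials_def bernoulli_trials_axioms_def)
  define Q where "Q S \<longleftrightarrow> streak_trials n k (indicator S) \<noteq> {}" for S
  define g where "g S = P_hat n k (indicator S)" for S
  have X: "X i \<omega> = indicator (successes \<omega>) i" if "i \<in> {1..n}" "\<omega> \<in> space M" for i \<omega>
    using that by (rule X_eq_indicator)
  have A: "A = {\<omega> \<in> space M. Q (successes \<omega>)}"
    using streak_trials_cong[OF X \<open>1 \<le> k\<close>] by (auto simp: A_def Q_def)
  have P_hat: "P_hat n k (\<lambda>i. X i \<omega>) = g (successes \<omega>)" if "\<omega> \<in> space M" for \<omega>
    unfolding g_def using P_hat_cong[OF X[OF _ that] \<open>1 \<le> k\<close>] .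
  have A_event: "A \<in> events"
    unfolding A by (rule events_successes)
  have prob_A: "prob A = bernoulli_mean p {1..n} (\<lambda>S. of_bool (Q S))"
    unfolding A by (rule prob_successes_pred)
  \<comment> \<open>The all-success sequence shows that the conditioning event has positive
    probability.\<close>
  have "k + 1 \<in> streak_trials n k (indicator {1..n})"
    using kn by (auto simp: streak_trials_indicator)
  then have "Q {1..n}" by (auto simp: Q_def)
  then have prob_A_pos: "0 < prob A"
    unfolding prob_A using assms(3,4) by (intro bernoulli_mean_pos[where T = "{1..n}"]) auto
  have "expectation_given M (\<lambda>\<omega>. P_hat n k (\<lambda>i. X i \<omega>)) A
      = (\<integral>\<omega>. indicator A \<omega> * P_hat n k (\<lambda>i. X i \<omega>) \<partial>M) / prob A"
    unfolding expectation_given_def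
  proof (rule integral_uniform_measure)
    show "(\<lambda>\<omega>. P_hat n k (\<lambda>i. X i \<omega>)) \<in> borel_measurable M"
      using borel_measurable_integrable[OF integrable_successes[of g]]
      by (subst measurable_cong[OF P_hat])
  qed (use A_event prob_A_pos in auto)
  also have "(\<integral>\<omega>. indicator A \<omega> * P_hat n k (\<lambda>i. X i \<omega>) \<partial>M)
      = (\<integral>\<omega>. of_bool (Q (successes \<omega>)) * g (successes \<omega>) \<partial>M)"
    by (intro Bochner_Integration.integral_cong refl) (auto simp: P_hat A)
  also have "\<dots> = bernoulli_mean p {1..n} (\<lambda>S. of_bool (Q S) * g S)"
    by (rule expectation_successes)
  finally have expectation: "expectation_given M (\<lambda>\<omega>. P_hat n k (\<lambda>i. X i \<omega>)) A
      = bernoulli_mean p {1..n} (\<lambda>S. of_bool (Q S) * g S) / prob A" .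
  \<comment> \<open>By linearity the mean of the right side is the numerator of the conditional
    expectation minus \<open>p * prob A\<close>.\<close>
  have "(\<lambda>S. if streak_trials n k (indicator S) = {} then 0 else P_hat n k (indicator S) - p)
      = (\<lambda>S. of_bool (Q S) * g S - p * of_bool (Q S))"
    by (auto simp: fun_eq_iff Q_def g_def)
  then have "bernoulli_mean p {1..n} (\<lambda>S. of_bool (Q S) * g S) - p * prob A < 0"
    using bernoulli_mean_P_hat_neg[OF assms(3,4,8) kn] unfolding prob_A
    by (simp only: bernoulli_mean_diff_mult)
  then have less: "expectation_given M (\<lambda>\<omega>. P_hat n k (\<lambda>i. X i \<omega>)) A < p"
    unfolding expectation using prob_A_pos by (simp add: divide_less_eq)
  \<comment> \<open>Here \<open>J\<close> is the window \<open>{t - k..t - 1}\<close>; since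
    \<open>k + 1 \<le> t \<le> n\<close> it lies in \<open>{1..n}\<close> and omits
    \<open>t\<close>.\<close>
  have "\<P>(\<omega> in M. X t \<omega> = 1 \<bar> (\<Prod>j = t - k..t - 1. X j \<omega>) = 1) = p" if "t \<in> {k + 1..n}" for t
    using that assms(3,4,8) by (intro cond_prob_success_given_others) auto
  then show ?thesis
    using less by (simp add: biased_estimator_given_def)
qed

end
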